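(* Let $G=(V,E)$, $V=\{1,\dots,n\}$, be a tree (a digraph whose underlying undirected graph is a tree) with at least one edge. Suppose the graph is known and all nodes are excited. Let $\mathcal N^m\subseteq V$ be the set of measured nodes. Then the network $G$ is identifiable in the class $\mathcal F_Z$ if and only if all the sinks of $G$ are measured, i.e. every sink belongs to $\mathcal N^m$. Moreover, identifiability remains true when only restricted data are used: if all sinks belong to $\mathcal N^m$ and $\{f\},\{\tilde f\}$ are two sets of edge functions in $\mathcal F_Z$ on $G$ (none identically zero), with corresponding functions $F_i,\tilde F_i$, then each of the following two conditions separately implies $\{f\}=\{\tilde f\}$: (1) (zero initial conditions, constant excitations) $F_i(0,\mathbf u,t)=\tilde F_i(0,\mathbf u,t)$ for all $i\in\mathcal N^m$, all constant excitation signals $\mathbf u\in\mathbb R^n$ and all $t\ge 0$; (2) (multiple initial conditions, zero excitations) $F_i(\mathbf x^0,0,t)=\tilde F_i(\mathbf x^0,0,t)$ for all $i\in\mathcal N^m$, all $\mathbf x^0\in\mathbb R^n$ and all $t\ge 0$.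
   Context: Network model. $G=(V,E)$ is a weakly connected digraph with $V=\{1,\dots,n\}$. The notation $(i,j)\in E$ means that there is an edge from $j$ to $i$, and $\mathcal N_i=\{j:(i,j)\in E\}$ is the set of in-neighbors of $i$. Each node has a scalar state $x_i\in\mathbb R$ evolving by $$\dot x_i(t)=\sum_{j\in\mathcal N_i}f_{i,j}(x_j(t))+u_i(t),\qquad x_i(0)=x_i^0,$$ where $f_{i,j}:\mathbb R\to\mathbb R$ is the function of edge $(i,j)$ and $u_i$ is an external excitation signal. Graph known: $G$ is known and $(i,j)\in E$ implies $f_{i,j}\not\equiv 0$; every candidate set of edge functions is indexed by the same $E$ and consists of functions that are not identically zero. Full excitation: every node $i$ has an input $u_i$ that can be chosen freely (in a fixed class of locally integrable signals $[0,\infty)\to\mathbb R$ containing all constant signals). Initial conditions $\mathbf x^0=(x_1^0,\dots,x_n^0)\in\mathbb R^n$ are also freely chosen variables. Functions $F_i$. For a set of edge functions $\{f\}=\{f_{i,j}:(i,j)\in E\}$, $F_i$ denotes the map giving the state of node $i$: $x_i(t)=F_i(\mathbf x^0,\mathbf u,t)$, as a function of initial conditions, excitation signals on $[0,t]$, and time $t\ge0$. Measuring node $i$ means knowing $F_i$. For a set $\mathcal N^m\subseteq V$ of measured nodes, $F(\mathcal N^m)=(F_i)_{i\in\mathcal N^m}$ is the family of measured functions generated by $\{f\}$; $\tilde F(\mathcal N^m)$ is the one generated by another set $\{\tilde f\}$. Identifiability. The network $G$ is identifiable in a class $\mathcal F$ (with measured nodes $\mathcal N^m$) if for every set $\{f\}=\{f_{i,j}\in\mathcal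 F:(i,j)\in E\}$ and every set $\{\tilde f\}=\{\tilde f_{i,j}\in\mathcal F:(i,j)\in E\}$, the equality $F(\mathcal N^m)=\tilde F(\mathcal N^m)$ implies $\{f\}=\{\tilde f\}$, i.e. $f_{i,j}=\tilde f_{i,j}$ for all $(i,j)\in E$. Class $\mathcal F_Z$: functions $f:\mathbb R\to\mathbb R$ that are real analytic on $\mathbb R$ and satisfy $f(0)=0$. A sink is a node with no outgoing edge. A tree may have several sources and several sinks. *)

theory Defs
  imports "HOL-Analysis.Analysis"
begin

section \<open>Digraphs\<close>

text \<open>
  A digraph is a vertex set \<open>V\<close> with an edge relation \<open>E\<close>, where \<open>(i, j) \<in> E\<close> is an edge
  \<^emph>\<open>from\<close> \<open>j\<close> \<^emph>\<open>to\<close> \<open>i\<close>.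
\<close>

definition in_neighbors :: "(nat \<times> nat) set \<Rightarrow> nat \<Rightarrow> nat set" where
  "in_neighbors E i = {j. (i, j) \<in> E}"

definition sinks :: "nat set \<Rightarrow> (nat \<times> nat) set \<Rightarrow> nat set" where
  "sinks V E = {j \<in> V. \<not> (\<exists>i. (i, j) \<in> E)}"

definition weakly_connected :: "nat set \<Rightarrow> (nat \<times> nat) set \<Rightarrow> bool" where
  "weakly_connected V E \<longleftrightarrow> (\<forall>i\<in>V. \<forall>j\<in>V. (i, j) \<in> (E \<union> E\<inverse>)\<^sup>*)"

definition joins :: "nat \<times> nat \<Rightarrow> nat \<Rightarrow> nat \<Rightarrow> bool" where
  "joins e a b \<longleftrightarrow> e = (a, b) \<or> e = (b, a)"

text \<open>
  A cycle of the underlying undirected multigraph: distinct vertices and distinct edges, the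
  \<open>k\<close>-th edge joining the \<open>k\<close>-th vertex to its cyclic successor. A loop is a cycle of length 1
  and a pair of antiparallel edges is a cycle of length 2, so a tree below is an orientation of an
  undirected tree.
\<close>

definition undirected_cycle :: "(nat \<times> nat) set \<Rightarrow> nat list \<Rightarrow> (nat \<times> nat) list \<Rightarrow> bool" where
  "undirected_cycle E vs es \<longleftrightarrow>
     vs \<noteq> [] \<and> length es = length vs \<and> distinct vs \<and> distinct es \<and> set es \<subseteq> E \<and>
     (\<forall>k<length vs. joins (es ! k) (vs ! k) (vs ! (Suc k mod length vs)))"

definition directed_tree :: "nat set \<Rightarrow> (nat \<times> nat) set \<Rightarrow> bool" where
  "directed_tree V E \<longleftrightarrow>
     finite V \<and> V \<noteq> {} \<and> E \<subseteq> V \<times> V \<and> weakly_connected V E \<and>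
     (\<nexists>vs es. undirected_cycle E vs es)"


section \<open>Signals and edge functions\<close>

text \<open>
  Signals on \<open>[0, \<infinity>)\<close> are total functions on the reals whose values at negative times are never
  used.
\<close>

definition locally_integrable :: "(real \<Rightarrow> real) \<Rightarrow> bool" where
  "locally_integrable u \<longleftrightarrow> (\<forall>t\<ge>0. u absolutely_integrable_on {0..t})"

definition real_analytic :: "(real \<Rightarrow> real) \<Rightarrow> bool" where
  "real_analytic f \<longleftrightarrow>
     (\<forall>a. \<exists>r>0. \<exists>c. \<forall>x. \<bar>x - a\<bar> < r \<longrightarrow> (\<lambda>k. c k * (x - a) ^ k) sums f x)"

definition class_FZ :: "(real \<Rightarrow> real) set" where
  "class_FZ = {f. real_analytic f \<and> f 0 = 0}"

definition edge_functions ::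
    "(nat \<times> nat) set \<Rightarrow> (real \<Rightarrow> real) set \<Rightarrow> (nat \<Rightarrow> nat \<Rightarrow> real \<Rightarrow> real) \<Rightarrow> bool" where
  "edge_functions E \<F> f \<longleftrightarrow> (\<forall>(i, j)\<in>E. f i j \<in> \<F> \<and> f i j \<noteq> (\<lambda>_. 0))"

definition same_edge_functions ::
    "(nat \<times> nat) set \<Rightarrow> (nat \<Rightarrow> nat \<Rightarrow> real \<Rightarrow> real) \<Rightarrow> (nat \<Rightarrow> nat \<Rightarrow> real \<Rightarrow> real) \<Rightarrow> bool" where
  "same_edge_functions E f g \<longleftrightarrow> (\<forall>(i, j)\<in>E. f i j = g i j)"


section \<open>Dynamics and identifiability\<close>

text \<open>
  Solutions of \<open>x\<^sub>i' = (\<Sum>j\<in>N\<^sub>i. f\<^sub>i\<^sub>j (x\<^sub>j)) + u\<^sub>i\<close>, \<open>x\<^sub>i(0) = x0\<^sub>i\<close> on \<open>[0, \<infinity>)\<close>. As the excitations are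
  only locally integrable, the equation is understood in the sense of Caratheodory, that is, in
  integrated form.
\<close>

definition trajectory ::
    "nat set \<Rightarrow> (nat \<times> nat) set \<Rightarrow> (nat \<Rightarrow> nat \<Rightarrow> real \<Rightarrow> real) \<Rightarrow>
     (nat \<Rightarrow> real) \<Rightarrow> (nat \<Rightarrow> real \<Rightarrow> real) \<Rightarrow> (nat \<Rightarrow> real \<Rightarrow> real) \<Rightarrow> bool" where
  "trajectory V E f x0 u x \<longleftrightarrow>
     (\<forall>i\<in>V. \<forall>t\<ge>0.
        (\<lambda>s. (\<Sum>j\<in>in_neighbors E i. f i j (x j s)) + u i s) absolutely_integrable_on {0..t} \<and>
        x i t = x0 i +
          integral {0..t} (\<lambda>s. (\<Sum>j\<in>in_neighbors E i. f i j (x j s)) + u i s))"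

text \<open>
  The function \<open>F\<^sub>i\<close>. On a tree with continuous edge functions the trajectory exists on all of
  \<open>[0, \<infinity>)\<close> and its values at nodes of \<open>V\<close> and times \<open>t \<ge> 0\<close> are unique, so the description is proper
  there.
\<close>

definition state_fun ::
    "nat set \<Rightarrow> (nat \<times> nat) set \<Rightarrow> (nat \<Rightarrow> nat \<Rightarrow> real \<Rightarrow> real) \<Rightarrow> nat \<Rightarrow>
     (nat \<Rightarrow> real) \<Rightarrow> (nat \<Rightarrow> real \<Rightarrow> real) \<Rightarrow> real \<Rightarrow> real" where
  "state_fun V E f i x0 u t = (THE y. \<exists>x. trajectory V E f x0 u x \<and> y = x i t)"

definition same_measurements ::
    "nat set \<Rightarrow> (nat \<times> nat) set \<Rightarrow> (real \<Rightarrow> real) set \<Rightarrow> nat set \<Rightarrow>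
     (nat \<Rightarrow> nat \<Rightarrow> real \<Rightarrow> real) \<Rightarrow> (nat \<Rightarrow> nat \<Rightarrow> real \<Rightarrow> real) \<Rightarrow> bool" where
  "same_measurements V E U M f g \<longleftrightarrow>
     (\<forall>i\<in>M. \<forall>x0 u t. (\<forall>k\<in>V. u k \<in> U) \<longrightarrow> 0 \<le> t \<longrightarrow>
        state_fun V E f i x0 u t = state_fun V E g i x0 u t)"

text \<open>\<open>U\<close> is the class of admissible excitation signals, \<open>M\<close> the set of measured nodes.\<close>

definition identifiable ::
    "nat set \<Rightarrow> (nat \<times> nat) set \<Rightarrow> (real \<Rightarrow> real) set \<Rightarrow> (real \<Rightarrow> real) set \<Rightarrow> nat set \<Rightarrow> bool" where
  "identifiable V E U \<F> M \<longleftrightarrow>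
     (\<forall>f g. edge_functions E \<F> f \<longrightarrow> edge_functions E \<F> g \<longrightarrow>
        same_measurements V E U M f g \<longrightarrow> same_edge_functions E f g)"

end

theory Submission
  imports Defs
begin

text \<open>
  Measurements propagate backwards along edges. Let \<open>x\<^sub>i\<close> be known and \<open>(i, j)\<close> an edge. In a tree the
  ancestors of \<open>j\<close> can be driven while all other in-neighbours of \<open>i\<close> stay at rest, so that
  \<open>x\<^sub>i' = f\<^sub>i\<^sub>j (x\<^sub>j)\<close>. Driving \<open>j\<close> alone reveals \<open>f\<^sub>i\<^sub>j\<close>. If the ancestors of \<open>j\<close> contribute \<open>w t\<close> to
  \<open>x\<^sub>j\<close> in one network and \<open>w' t\<close> in the other, then driving \<open>j\<close> in addition shows that
  \<open>f\<^sub>i\<^sub>j (z + w t) = f\<^sub>i\<^sub>j (z + w' t)\<close> for every \<open>z\<close>. By continuity, \<open>w \<noteq> w'\<close> would make \<open>f\<^sub>i\<^sub>j\<close> periodic with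
  arbitrarily small periods and hence identically zero; so \<open>x\<^sub>j\<close> is known as well. Conversely,
  rescaling the edges into an unmeasured sink changes no other state.
\<close>


section \<open>Paths in trees\<close>

lemma simple_path_exists:
  assumes "(a, b) \<in> S\<^sup>*"
  shows "\<exists>vs. vs \<noteq> [] \<and> distinct vs \<and> hd vs = a \<and> last vs = b \<and>
    successively (\<lambda>x y. (x, y) \<in> S) vs"
  using assms
proof (induction rule: converse_rtrancl_induct)
  case base
  show ?case by (intro exI[of _ "[b]"]) simp
next
  case (step a c)
  then obtain vs where vs: "vs \<noteq> []" "distinct vs" "hd vs = c" "last vs = b"
    "successively (\<lambda>x y. (x, y) \<in> S) vs"
    by blast
  show ?case
  proof (cases "a \<in> set vs")
    case True
    \<comment> \<open>Discarding everything before \<open>a\<close> keeps the list distinct.\<close>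
    then obtain ys zs where "vs = ys @ a # zs"
      by (meson split_list)
    with vs show ?thesis
      by (intro exI[of _ "a # zs"]) (auto simp: successively_append_iff)
  next
    case False
    with vs step(1) show ?thesis
      by (intro exI[of _ "a # vs"]) (auto simp: successively_Cons)
  qed
qed

text \<open>A simple path avoiding an edge but joining its ends closes up to a cycle.\<close>

lemma edge_is_bridge:
  assumes nocyc: "\<nexists>vs es. undirected_cycle E vs es" and ij: "(i, j) \<in> E"
  defines "R \<equiv> E - {(i, j)}"
  shows "(i, j) \<notin> (R \<union> R\<inverse>)\<^sup>*"
proof
  assume "(i, j) \<in> (R \<union> R\<inverse>)\<^sup>*"
  from simple_path_exists[OF this] obtain vs where vs: "vs \<noteq> []" "distinct vs" "hd vs = i"
    "last vs = j" and succ: "successively (\<lambda>x y. (x, y) \<in> R \<union> R\<inverse>) vs"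
    by blast
  define m where "m = length vs - 1"
  have len: "length vs = Suc m"
    using vs(1) by (simp add: m_def)
  \<comment> \<open>\<open>succ\<close> only guarantees that one of the two orientations lies in
    \<open>R\<close>; \<open>e k\<close> picks one that does.\<close>
  define e where "e k = (if (vs ! k, vs ! Suc k) \<in> R then (vs ! k, vs ! Suc k)
    else (vs ! Suc k, vs ! k))" for k
  \<comment> \<open>The edge \<open>(i, j)\<close> closes the path from its last vertex
    \<open>j\<close> to its first vertex \<open>i\<close>.\<close>
  define es where "es = map e [0..<m] @ [(i, j)]"
  have eR: "e k \<in> R" if "k < m" for k
    using succ that len by (auto simp: e_def successively_conv_nth)
  have ej: "joins (e k) (vs ! k) (vs ! Suc k)" for k
    by (auto simp: e_def joins_def)
  have einj: "k = l" if "k < m" "l < m" "e k = e l" for k l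
  proof -
    have inj: "a = b" if "vs ! a = vs ! b" "a \<le> m" "b \<le> m" for a b
      using that vs(2) len by (simp add: nth_eq_iff_index_eq)
    \<comment> \<open>An edge used twice is traversed in the same or in opposite directions; the
      latter would force \<open>k = Suc l\<close> and \<open>Suc k = l\<close>.\<close>
    have "vs ! k = vs ! l \<or> (vs ! k = vs ! Suc l \<and> vs ! Suc k = vs ! l)"
      using that(3) by (auto simp: e_def split: if_splits)
    then show ?thesis
      using inj[of k l] inj[of k "Suc l"] inj[of "Suc k" l] that by force
  qed
  have "undirected_cycle E vs es"
    unfolding undirected_cycle_def
  proof (intro conjI allI impI)
    show "distinct es"
      using einj eR by (fastforce simp: es_def distinct_map inj_on_def R_def)
    show "set es \<subseteq> E"
      using eR ij by (auto simp: es_def R_def)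
    show "joins (es ! k) (vs ! k) (vs ! (Suc k mod length vs))" if "k < length vs" for k
    proof (cases "k < m")
      case True
      then show ?thesis
        using ej[of k] len by (simp add: es_def nth_append)
    next
      case False
      then have "k = m"
        using that len by simp
      then show ?thesis
        using vs len by (simp add: es_def nth_append joins_def last_conv_nth hd_conv_nth)
    qed
  qed (use vs len in \<open>auto simp: es_def\<close>)
  with nocyc show False
    by blast
qed

text \<open>A directed cycle through \<open>i\<close> uses some edge \<open>(i, j)\<close>. The rest
  of it, cut at the first visit to \<open>i\<close>, joins \<open>j\<close> to \<open>i\<close>
  without that edge, which is then no bridge.\<close>

lemma tree_acyclic:
  assumes nocyc: "\<nexists>vs es. undirected_cycle E vs es"
  shows "acyclic E"
proof (rule acyclicI, intro allI notI)
  fix i assume "(i, i) \<in> E\<^sup>+"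
  then obtain j where ij: "(i, j) \<in> E" and ji: "(j, i) \<in> E\<^sup>*"
    by (meson tranclD)
  define R where "R = E - {(i, j)}"
  from ji have "(j, i) \<in> R\<^sup>*"
  proof (induction rule: converse_rtrancl_induct)
    case (step a b)
    then show ?case
      by (cases "a = i") (auto simp: R_def intro: converse_rtrancl_into_rtrancl)
  qed simp
  then have "(i, j) \<in> (R\<inverse>)\<^sup>*"
    by (simp add: rtrancl_converse)
  then have "(i, j) \<in> (R \<union> R\<inverse>)\<^sup>*"
    by (meson Un_upper2 rtrancl_mono subsetD)
  with edge_is_bridge[OF nocyc ij] show False
    by (simp add: R_def)
qed

text \<open>Here \<open>(j, a) \<in> E\<^sup>*\<close> means that \<open>a\<close> is an ancestor of
  \<open>j\<close>. A common ancestor of \<open>j\<close> and \<open>k\<close> would link them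
  without \<open>(i, j)\<close>, and \<open>(i, k)\<close> would complete a detour around the bridge
  \<open>(i, j)\<close>.\<close>

lemma tree_disjoint_ancestors:
  assumes nocyc: "\<nexists>vs es. undirected_cycle E vs es"
    and ij: "(i, j) \<in> E" and ik: "(i, k) \<in> E" and "j \<noteq> k" and ja: "(j, a) \<in> E\<^sup>*"
  shows "(k, a) \<notin> E\<^sup>*"
proof
  assume ka: "(k, a) \<in> E\<^sup>*"
  define R where "R = E - {(i, j)}"
  \<comment> \<open>By acyclicity a chain of ancestors starting at an in-neighbour \<open>b\<close>
    of \<open>i\<close> never visits \<open>i\<close>, so it cannot contain
    \<open>(i, j)\<close>.\<close>
  have avoid: "(b, a) \<in> R\<^sup>*" if "(b, a) \<in> E\<^sup>*" "(i, b) \<in> E" for b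
  proof -
    have "(b, i) \<notin> E\<^sup>*"
      using tree_acyclic[OF nocyc] that(2) by (meson acyclic_def rtrancl_into_trancl2)
    from that(1) this show ?thesis
    proof (induction rule: rtrancl_induct)
      case (step y z)
      then show ?case
        by (cases "y = i") (auto simp: R_def intro: rtrancl_into_rtrancl)
    qed simp
  qed
  let ?S = "R \<union> R\<inverse>"
  have "(k, a) \<in> ?S\<^sup>*"
    using avoid[OF ka ik] by (meson Un_upper1 rtrancl_mono subsetD)
  moreover have "(a, j) \<in> ?S\<^sup>*"
    using avoid[OF ja ij] rtrancl_converse[of R]
    by (metis Un_upper2 converse_iff rtrancl_mono subsetD)
  moreover have "(i, k) \<in> ?S"
    using ik \<open>j \<noteq> k\<close> by (auto simp: R_def)
  ultimately have "(i, j) \<in> ?S\<^sup>*"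
    by (meson converse_rtrancl_into_rtrancl rtrancl_trans)
  with edge_is_bridge[OF nocyc ij] show False
    by (simp add: R_def)
qed


section \<open>Continuous functions on the line\<close>

lemma real_analytic_continuous:
  assumes "real_analytic f"
  shows "continuous_on UNIV f"
proof -
  have "isCont f a" for a
  proof -
    obtain r c where r: "r > 0"
      and s: "\<And>x. \<bar>x - a\<bar> < r \<Longrightarrow> (\<lambda>k. c k * (x - a) ^ k) sums f x"
      using assms unfolding real_analytic_def by meson
    have "summable (\<lambda>k. c k * (r / 2) ^ k)"
      using s[of "a + r / 2"] r by (simp add: sums_iff)
    then have "isCont (\<lambda>x. \<Sum>k. c k * x ^ k) 0"
      by (rule isCont_powser) (use r in auto)
    then have "isCont (\<lambda>x. \<Sum>k. c k * (x - a) ^ k) a"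
      by (intro isCont_o2[where f = "\<lambda>x. x - a" and g = "\<lambda>x. \<Sum>k. c k * x ^ k"]) auto
    moreover have "eventually (\<lambda>x. f x = (\<Sum>k. c k * (x - a) ^ k)) (nhds a)"
      unfolding eventually_nhds_metric
      using r s by (intro exI[of _ r]) (auto simp: dist_real_def sums_iff)
    ultimately show ?thesis
      using isCont_cong by force
  qed
  then show ?thesis
    by (simp add: continuous_at_imp_continuous_on)
qed

lemma real_analytic_scale: "real_analytic (\<lambda>x. b * x)"
  unfolding real_analytic_def
proof (intro allI exI[of _ "1::real"] conjI)
  fix a
  show "\<exists>c. \<forall>x. \<bar>x - a\<bar> < 1 \<longrightarrow> (\<lambda>k. c k * (x - a) ^ k) sums (b * x)"
  proof (intro exI allI impI)
    fix x
    \<comment> \<open>Expanded at \<open>a\<close>, the linear function is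
      \<open>b * a + b * (x - a)\<close>.\<close>
    have "(\<lambda>k. (if k = 0 then b * a else if k = 1 then b else 0) * (x - a) ^ k) sums
      (\<Sum>k\<in>{0, 1}. (if k = 0 then b * a else if k = 1 then b else 0) * (x - a) ^ k)"
      by (rule sums_finite) auto
    then show "(\<lambda>k. (if k = 0 then b * a else if k = 1 then b else 0) * (x - a) ^ k) sums (b * x)"
      by (simp add: algebra_simps)
  qed
qed simp

text \<open>Both integrals are differentiated in \<open>t\<close>. At \<open>t > 0\<close> the
  derivative is two-sided, hence unique.\<close>

lemma equal_integrals_imp_equal:
  fixes h1 h2 :: "real \<Rightarrow> real"
  assumes h: "continuous_on {0..} h1" "continuous_on {0..} h2"
    and eq: "\<And>t. t \<ge> 0 \<Longrightarrow> integral {0..t} h1 = integral {0..t} h2"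
    and t: "t > 0"
  shows "h1 t = h2 t"
proof -
  have deriv: "((\<lambda>t. integral {0..t} h) has_vector_derivative h t) (at t)"
    if "continuous_on {0..} h" for h :: "real \<Rightarrow> real"
  proof -
    have "continuous_on {0..t + 1} h"
      using that by (rule continuous_on_subset) auto
    then have "((\<lambda>t. integral {0..t} h) has_vector_derivative h t) (at t within {0..t + 1})"
      using t by (intro integral_has_vector_derivative) auto
    moreover have "at t within {0..t + 1} = at t"
      by (rule at_within_interior) (use t in simp)
    ultimately show ?thesis
      by metis
  qed
  have "((\<lambda>t. integral {0..t} h1) has_vector_derivative h2 t) (at t)"
    by (rule has_vector_derivative_transform_within_open[OF deriv[OF h(2)], of "{0<..}"])
      (use t eq in auto)
  with deriv[OF h(1)] show ?thesis
    by (rule vector_derivative_unique_at)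
qed

text \<open>The periods take all values between \<open>0\<close> and \<open>d t0\<close>, in particular \<open>\<bar>x\<bar> / m\<close> for some \<open>m\<close>.\<close>

lemma continuous_periods_imp_constant:
  fixes f d :: "real \<Rightarrow> real"
  assumes d: "continuous_on {0..} d" "d 0 = 0" and t0: "t0 \<ge> 0" "d t0 \<noteq> 0"
    and per: "\<And>z t. t \<ge> 0 \<Longrightarrow> f (z + d t) = f z"
  shows "f x = f 0"
proof -
  have cont: "continuous_on {0..t0} d"
    using d(1) by (rule continuous_on_subset) auto
  have shift: "f (z + e) = f z" if e: "0 \<le> e" "e \<le> \<bar>d t0\<bar>" for z e
  proof (cases "d t0 > 0")
    case True
    then obtain t where "0 \<le> t" "d t = e"
      using IVT'[of d 0 e t0] cont t0 d(2) e by auto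
    then show ?thesis
      using per[of t z] by simp
  next
    case False
    \<comment> \<open>Here the available period is \<open>- e\<close>; it is applied at
      \<open>z + e\<close>.\<close>
    then obtain t where "0 \<le> t" "d t = - e"
      using IVT2'[of d t0 "- e" 0] cont t0 d(2) e by auto
    then show ?thesis
      using per[of t "z + e"] by simp
  qed
  have multiple: "f (z + real m * e) = f z" if "0 \<le> e" "e \<le> \<bar>d t0\<bar>" for z e m
  proof (induction m)
    case (Suc m)
    have "f (z + real (Suc m) * e) = f ((z + real m * e) + e)"
      by (rule arg_cong[where f = f]) (simp add: algebra_simps)
    also have "\<dots> = f z"
      using shift[OF that] Suc by metis
    finally show ?case .
  qed simp
  obtain m where m: "\<bar>x\<bar> < real m * \<bar>d t0\<bar>"
    using reals_Archimedean3[of "\<bar>d t0\<bar>"] t0 by auto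
  then have "m > 0"
    by (cases m) auto
  then have "\<bar>x\<bar> / real m \<le> \<bar>d t0\<bar>" "real m * (\<bar>x\<bar> / real m) = \<bar>x\<bar>"
    using m by (auto simp: field_simps)
  then have "f (z + \<bar>x\<bar>) = f z" for z
    using multiple[of "\<bar>x\<bar> / real m" z m] by simp
  \<comment> \<open>For negative \<open>x\<close> the shift by \<open>\<bar>x\<bar>\<close> starts
    at \<open>x\<close> and ends at \<open>0\<close>.\<close>
  from this[of 0] this[of x] show ?thesis
    by (cases "x \<ge> 0") auto
qed


section \<open>Trajectories\<close>

lemma wf_converse_edges:
  assumes "finite V" "E \<subseteq> V \<times> V" "acyclic E"
  shows "wf (E\<inverse>)"
  using assms by (meson finite_SigmaI finite_acyclic_wf_converse finite_subset)

text \<open>The integrand at \<open>i\<close> involves only in-neighbours, so well-founded recursion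
  defines the states. The equation holds even for non-integrable integrands, whose integral is
  \<open>0\<close> by convention.\<close>

lemma integral_equation_solution:
  assumes wf: "wf (E\<inverse>)"
  shows "\<exists>x :: nat \<Rightarrow> real \<Rightarrow> real. \<forall>i t. x i t = x0 i +
    integral {0..t} (\<lambda>s. (\<Sum>j\<in>in_neighbors E i. f i j (x j s)) + u i s)"
proof -
  define F where "F x i t = x0 i +
    integral {0..t} (\<lambda>s. (\<Sum>j\<in>in_neighbors E i. f i j (x j s)) + u i s)"
    for x :: "nat \<Rightarrow> real \<Rightarrow> real" and i t
  define x where "x = wfrec (E\<inverse>) F"
  have "x i = F x i" for i
  proof -
    have "x i = F (cut x (E\<inverse>) i) i"
      unfolding x_def by (rule wfrec[OF wf])
    also have "\<dots> = F x i"
      unfolding F_def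
      by (intro ext arg_cong2[where f = "(+)"] refl integral_cong sum.cong)
        (simp add: cut_apply in_neighbors_def)
    finally show ?thesis .
  qed
  then show ?thesis
    unfolding F_def by (intro exI[of _ x]) metis
qed

lemma trajectory_unique:
  assumes wf: "wf (E\<inverse>)" and E: "E \<subseteq> V \<times> V"
    and x: "trajectory V E f x0 u x" and y: "trajectory V E f x0 u y"
  shows "i \<in> V \<Longrightarrow> t \<ge> 0 \<Longrightarrow> x i t = y i t"
proof (induction i arbitrary: t rule: wf_induct_rule[OF wf])
  case (1 i)
  have "integral {0..t} (\<lambda>s. (\<Sum>j\<in>in_neighbors E i. f i j (x j s)) + u i s) =
      integral {0..t} (\<lambda>s. (\<Sum>j\<in>in_neighbors E i. f i j (y j s)) + u i s)"
  proof (intro integral_cong arg_cong2[where f = "(+)"] refl sum.cong)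
    fix s j assume "s \<in> {0..t}" "j \<in> in_neighbors E i"
    then show "f i j (x j s) = f i j (y j s)"
      using 1(1)[of j s] E by (auto simp: in_neighbors_def)
  qed
  then show ?case
    using x y 1 unfolding trajectory_def by simp
qed

lemma state_fun_eq:
  assumes "wf (E\<inverse>)" "E \<subseteq> V \<times> V" "trajectory V E f x0 u x" "i \<in> V" "t \<ge> 0"
  shows "state_fun V E f i x0 u t = x i t"
  unfolding state_fun_def
  by (rule the_equality) (use assms trajectory_unique in blast)+

text \<open>Replaces the definite description by an integral equation. Continuity passes from
  in-neighbours to each node and makes the integrands absolutely integrable, so the recursive
  solution is a trajectory; uniqueness identifies it with \<open>state_fun\<close>.\<close>

lemma state_fun_equation:
  assumes wf: "wf (E\<inverse>)" and E: "E \<subseteq> V \<times> V"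
    and f: "\<And>i j. (i, j) \<in> E \<Longrightarrow> continuous_on UNIV (f i j)"
    and u: "\<And>i. continuous_on {0..} (u i)"
    and i: "i \<in> V"
  shows "continuous_on {0..} (state_fun V E f i x0 u)"
    and "t \<ge> 0 \<Longrightarrow> state_fun V E f i x0 u t = x0 i +
      integral {0..t} (\<lambda>s. (\<Sum>j\<in>in_neighbors E i. f i j (state_fun V E f j x0 u s)) + u i s)"
proof -
  obtain x :: "nat \<Rightarrow> real \<Rightarrow> real" where x: "\<And>i t. x i t = x0 i +
      integral {0..t} (\<lambda>s. (\<Sum>j\<in>in_neighbors E i. f i j (x j s)) + u i s)"
    using integral_equation_solution[OF wf] by metis
  define h where "h i s = (\<Sum>j\<in>in_neighbors E i. f i j (x j s)) + u i s" for i s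
  have h_cont: "continuous_on {0..} (h i)"
    if "\<And>j. (i, j) \<in> E \<Longrightarrow> continuous_on {0..} (x j)" for i
    unfolding h_def
    by (intro continuous_intros continuous_on_compose2[OF f] that u) (auto simp: in_neighbors_def)
  have h_abs: "h i absolutely_integrable_on {0..t}" if "continuous_on {0..} (h i)" for i t
  proof (rule absolutely_integrable_continuous_real)
    show "continuous_on {0..t} (h i)"
      using that by (rule continuous_on_subset) auto
  qed
  have x_cont: "continuous_on {0..} (x i)" for i
  proof (induction i rule: wf_induct_rule[OF wf])
    case (1 i)
    have hc: "continuous_on {0..} (h i)"
      by (rule h_cont) (use 1 in auto)
    have xc: "continuous_on {0..T} (x i)" for T
    proof -
      have "continuous_on {0..T} (\<lambda>t. x0 i + integral {0..t} (h i))"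
        using h_abs[OF hc, of T]
        by (intro continuous_intros indefinite_integral_continuous_1 set_lebesgue_integral_eq_integral)
      also have "(\<lambda>t. x0 i + integral {0..t} (h i)) = x i"
        unfolding h_def by (rule ext) (rule x[symmetric])
      finally show ?thesis .
    qed
    show ?case
      unfolding continuous_on_eq_continuous_within
    proof
      fix t :: real assume t: "t \<in> {0..}"
      have "continuous (at t within {0..t + 1}) (x i)"
        using xc[of "t + 1"] t by (simp add: continuous_on_eq_continuous_within)
      \<comment> \<open>Continuity is local: near \<open>t\<close> the sets
        \<open>{0..t + 1}\<close> and \<open>{0..}\<close> coincide.\<close>
      moreover have "at t within {0..t + 1} = at t within {0..}"
        by (rule at_within_nhd[of _ "{..<t + 1}"]) auto
      ultimately show "continuous (at t within {0..}) (x i)"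
        by simp
    qed
  qed
  have "trajectory V E f x0 u x"
    unfolding trajectory_def
    by (intro ballI allI impI conjI x) (rule h_abs[OF h_cont[OF x_cont], unfolded h_def[abs_def]])
  note state = state_fun_eq[OF wf E this]
  show "continuous_on {0..} (state_fun V E f i x0 u)"
    using continuous_on_cong[of "{0..}" "{0..}" "state_fun V E f i x0 u" "x i"]
      x_cont state[OF i] by auto
  assume t: "t \<ge> 0"
  have "integral {0..t} (\<lambda>s. (\<Sum>j\<in>in_neighbors E i. f i j (x j s)) + u i s) =
     integral {0..t} (\<lambda>s. (\<Sum>j\<in>in_neighbors E i. f i j (state_fun V E f j x0 u s)) + u i s)"
  proof (intro integral_cong arg_cong2[where f = "(+)"] refl sum.cong)
    fix s j assume "s \<in> {0..t}" "j \<in> in_neighbors E i"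
    then show "f i j (x j s) = f i j (state_fun V E f j x0 u s)"
      using state[of j s] E by (auto simp: in_neighbors_def)
  qed
  then show "state_fun V E f i x0 u t = x0 i +
      integral {0..t} (\<lambda>s. (\<Sum>j\<in>in_neighbors E i. f i j (state_fun V E f j x0 u s)) + u i s)"
    using state[OF i t] x[of i t] by simp
qed


section \<open>Responses to a parameter vector\<close>

text \<open>Constant excitations from rest are the case \<open>\<alpha> t = t\<close>, free motions from a chosen initial
  condition the case \<open>\<alpha> t = 1\<close>.\<close>

locale network_response =
  fixes V :: "nat set" and E :: "(nat \<times> nat) set" and f :: "nat \<Rightarrow> nat \<Rightarrow> real \<Rightarrow> real"
    and \<alpha> :: "real \<Rightarrow> real" and X :: "(nat \<Rightarrow> real) \<Rightarrow> nat \<Rightarrow> real \<Rightarrow> real"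
  assumes fin: "finite V" and edges: "E \<subseteq> V \<times> V"
    and no_cycle: "\<nexists>vs es. undirected_cycle E vs es"
    and f_cont: "\<And>i j. (i, j) \<in> E \<Longrightarrow> continuous_on UNIV (f i j)"
    and f_zero: "\<And>i j. (i, j) \<in> E \<Longrightarrow> f i j 0 = 0"
    and \<alpha>_pos: "\<And>t. t > 0 \<Longrightarrow> \<alpha> t > 0"
    and X_cont: "\<And>p i. i \<in> V \<Longrightarrow> continuous_on {0..} (X p i)"
    and X_eq: "\<And>p i t. i \<in> V \<Longrightarrow> t \<ge> 0 \<Longrightarrow> X p i t = p i * \<alpha> t +
      integral {0..t} (\<lambda>s. \<Sum>j\<in>in_neighbors E i. f i j (X p j s))"
begin

lemma acyclic: "acyclic E"
  using tree_acyclic no_cycle .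

lemma wf_parents: "wf (E\<inverse>)"
  using wf_converse_edges fin edges acyclic .

lemma response_local:
  assumes "i \<in> V" "t \<ge> 0" "\<And>k. (i, k) \<in> E\<^sup>* \<Longrightarrow> p k = q k"
  shows "X p i t = X q i t"
  using assms
proof (induction i arbitrary: t rule: wf_induct_rule[OF wf_parents])
  case (1 i)
  have "integral {0..t} (\<lambda>s. \<Sum>j\<in>in_neighbors E i. f i j (X p j s)) =
      integral {0..t} (\<lambda>s. \<Sum>j\<in>in_neighbors E i. f i j (X q j s))"
  proof (intro integral_cong sum.cong refl)
    fix s j assume "s \<in> {0..t}" "j \<in> in_neighbors E i"
    then show "f i j (X p j s) = f i j (X q j s)"
      using 1(1)[of j s] 1(4) edges
      by (auto simp: in_neighbors_def intro!: arg_cong[of _ _ "f i j"]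
        intro: converse_rtrancl_into_rtrancl)
  qed
  then show ?case
    using 1(2-4) X_eq by simp
qed

text \<open>By \<open>f_zero\<close> a node at rest transmits nothing.\<close>

lemma response_zero:
  assumes "i \<in> V" "t \<ge> 0" "\<And>k. (i, k) \<in> E\<^sup>* \<Longrightarrow> p k = 0"
  shows "X p i t = 0"
  using assms
proof (induction i arbitrary: t rule: wf_induct_rule[OF wf_parents])
  case (1 i)
  have "integral {0..t} (\<lambda>s. \<Sum>j\<in>in_neighbors E i. f i j (X p j s)) = integral {0..t} (\<lambda>_. 0)"
  proof (intro integral_cong sum.neutral ballI)
    fix s j assume s: "s \<in> {0..t}" and "j \<in> in_neighbors E i"
    then have j: "(i, j) \<in> E"
      by (simp add: in_neighbors_def)
    then have "X p j s = 0"
      using 1(1)[of j s] 1(4) edges s by (auto intro: converse_rtrancl_into_rtrancl)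
    then show "f i j (X p j s) = 0"
      using f_zero[OF j] by simp
  qed
  then show ?case
    using 1(2-4) X_eq by simp
qed

text \<open>Since \<open>j\<close> is not its own proper ancestor, changing \<open>p j\<close>
  leaves the inflow into \<open>j\<close> unchanged. Thus the state of \<open>j\<close> at any fixed
  positive time can be set to any value.\<close>

lemma response_shift:
  assumes j: "j \<in> V" and t: "t \<ge> 0"
  shows "X (p(j := p j + s)) j t = X p j t + s * \<alpha> t"
proof -
  have "integral {0..t} (\<lambda>r. \<Sum>k\<in>in_neighbors E j. f j k (X (p(j := p j + s)) k r)) =
      integral {0..t} (\<lambda>r. \<Sum>k\<in>in_neighbors E j. f j k (X p k r))"
  proof (intro integral_cong sum.cong refl arg_cong[where f = "f j k" for k] response_local)
    fix r k l assume k: "k \<in> in_neighbors E j" and "(k, l) \<in> E\<^sup>*"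
    then have "(j, l) \<in> E\<^sup>+"
      by (simp add: in_neighbors_def rtrancl_into_trancl2)
    then have "j \<noteq> l"
      using acyclic by (auto simp: acyclic_def)
    then show "(p(j := p j + s)) l = p l"
      by simp
  qed (use edges in \<open>auto simp: in_neighbors_def\<close>)
  then show ?thesis
    using X_eq[OF j t] by (simp add: algebra_simps)
qed

text \<open>The other in-neighbours of \<open>i\<close> have no ancestor in common with \<open>j\<close> and stay at rest.\<close>

lemma response_isolated:
  assumes ij: "(i, j) \<in> E" and t: "t \<ge> 0" and p: "\<And>k. (j, k) \<notin> E\<^sup>* \<Longrightarrow> p k = 0"
  shows "X p i t = integral {0..t} (\<lambda>s. f i j (X p j s))"
proof -
  have V: "i \<in> V" "j \<in> V"
    using ij edges by auto
  have "(j, i) \<notin> E\<^sup>*"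
    using acyclic ij by (meson acyclic_def rtrancl_into_trancl2)
  then have "p i = 0"
    by (rule p)
  moreover have "integral {0..t} (\<lambda>s. \<Sum>k\<in>in_neighbors E i. f i k (X p k s)) =
      integral {0..t} (\<lambda>s. f i j (X p j s))"
  proof (rule integral_cong)
    fix s assume s: "s \<in> {0..t}"
    have fin_in: "finite (in_neighbors E i)"
      using fin edges by (auto simp: in_neighbors_def intro: finite_subset)
    have "f i k (X p k s) = 0" if "k \<in> in_neighbors E i - {j}" for k
    proof -
      have ik: "(i, k) \<in> E" "j \<noteq> k"
        using that by (auto simp: in_neighbors_def)
      have "p l = 0" if "(k, l) \<in> E\<^sup>*" for l
        using tree_disjoint_ancestors[OF no_cycle ij ik] that p by blast
      then have "X p k s = 0"
        using ik edges s by (intro response_zero) auto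
      then show ?thesis
        using f_zero[OF ik(1)] by simp
    qed
    then have "(\<Sum>k\<in>in_neighbors E i. f i k (X p k s)) = (\<Sum>k\<in>{j}. f i k (X p k s))"
      by (intro sum.mono_neutral_right) (use fin_in ij in \<open>auto simp: in_neighbors_def\<close>)
    then show "(\<Sum>k\<in>in_neighbors E i. f i k (X p k s)) = f i j (X p j s)"
      by simp
  qed
  ultimately show ?thesis
    using X_eq[OF V(1) t] by simp
qed

lemma transmitted_continuous:
  assumes "(i, j) \<in> E"
  shows "continuous_on {0..} (\<lambda>s. f i j (X p j s))"
  using assms edges by (intro continuous_on_compose2[OF f_cont X_cont]) auto

end

section \<open>Backward propagation from the sinks\<close>

lemma response_determines_parent:
  assumes "network_response V E f \<alpha> X" "network_response V E g \<alpha> Y"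
    and ij: "(i, j) \<in> E" and nz: "f i j \<noteq> (\<lambda>_. 0)"
    and eq: "\<And>p t. t \<ge> 0 \<Longrightarrow> X p i t = Y p i t"
  shows "f i j = g i j" and "\<And>p t. t \<ge> 0 \<Longrightarrow> X p j t = Y p j t"
proof -
  interpret f: network_response V E f \<alpha> X by fact
  interpret g: network_response V E g \<alpha> Y by fact
  have j: "j \<in> V"
    using ij f.edges by auto
  have transmitted: "f i j (X p j t) = g i j (Y p j t)"
    if "t > 0" "\<And>k. (j, k) \<notin> E\<^sup>* \<Longrightarrow> p k = 0" for p t
    using f.transmitted_continuous[OF ij] g.transmitted_continuous[OF ij] _ that(1)
  proof (rule equal_integrals_imp_equal)
    show "integral {0..t} (\<lambda>s. f i j (X p j s)) = integral {0..t} (\<lambda>s. g i j (Y p j s))"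
      if "t \<ge> 0" for t
      using f.response_isolated[OF ij that, of p] g.response_isolated[OF ij that, of p]
        eq[OF that] \<open>\<And>k. (j, k) \<notin> E\<^sup>* \<Longrightarrow> p k = 0\<close> by simp
  qed
  show fg: "f i j = g i j"
  proof
    fix z
    \<comment> \<open>Driving \<open>j\<close> alone with strength \<open>z / \<alpha> 1\<close>
      brings its state to \<open>z\<close> at time 1.\<close>
    define p where "p = (\<lambda>_::nat. 0::real)(j := 0 + z / \<alpha> 1)"
    have "X p j 1 = z" "Y p j 1 = z"
      using f.response_shift[OF j, of 1 "\<lambda>_. 0" "z / \<alpha> 1"] f.response_zero[OF j, of 1 "\<lambda>_. 0"]
        g.response_shift[OF j, of 1 "\<lambda>_. 0" "z / \<alpha> 1"] g.response_zero[OF j, of 1 "\<lambda>_. 0"]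
        f.\<alpha>_pos[of 1] by (simp_all add: p_def)
    moreover have "p k = 0" if "(j, k) \<notin> E\<^sup>*" for k
      using that by (auto simp: p_def)
    ultimately show "f i j z = g i j z"
      using transmitted[of 1 p] by simp
  qed
  fix p :: "nat \<Rightarrow> real" and t :: real assume t: "t \<ge> 0"
  \<comment> \<open>Truncating \<open>p\<close> to the ancestors of \<open>j\<close> preserves the
    state of \<open>j\<close> and makes \<open>transmitted\<close> applicable.\<close>
  define q :: "nat \<Rightarrow> real" where "q k = (if (j, k) \<in> E\<^sup>* then p k else 0)" for k
  define d where "d t = X q j t - Y q j t" for t
  have period: "f i j (z + d t) = f i j z" if "t \<ge> 0" for z t
  proof (cases "t = 0")
    \<comment> \<open>At time 0 the factor \<open>\<alpha> t\<close> may vanish, but both states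
      equal \<open>q j * \<alpha> 0\<close>, so \<open>d 0 = 0\<close>.\<close>
    case True
    then show ?thesis
      using f.X_eq[OF j, of 0 q] g.X_eq[OF j, of 0 q] by (simp add: d_def)
  next
    case False
    then have pos: "t > 0" "\<alpha> t > 0"
      using that f.\<alpha>_pos by auto
    \<comment> \<open>This shift moves the second network's state at \<open>j\<close> to
      \<open>z\<close>, hence the first one's to \<open>z + d t\<close>.\<close>
    define s where "s = (z - Y q j t) / \<alpha> t"
    have "X (q(j := q j + s)) j t = z + d t" "Y (q(j := q j + s)) j t = z"
      using f.response_shift[OF j that, of q s] g.response_shift[OF j that, of q s] pos
      by (simp_all add: s_def d_def)
    moreover have "(q(j := q j + s)) k = 0" if "(j, k) \<notin> E\<^sup>*" for k
      using that by (auto simp: q_def)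
    ultimately show ?thesis
      using transmitted[OF pos(1), of "q(j := q j + s)"] fg by simp
  qed
  have "continuous_on {0..} d"
    unfolding d_def by (intro continuous_intros f.X_cont g.X_cont j)
  moreover have "d 0 = 0"
    using f.X_eq[OF j, of 0 q] g.X_eq[OF j, of 0 q] by (simp add: d_def)
  \<comment> \<open>Otherwise \<open>f i j\<close> would be constant with value
    \<open>f i j 0 = 0\<close>, contradicting \<open>nz\<close>.\<close>
  ultimately have "d t = 0"
    using continuous_periods_imp_constant[of d t "f i j"] t period nz f.f_zero[OF ij] by fastforce
  moreover have "X p j t = X q j t" "Y p j t = Y q j t"
    using f.response_local[OF j t, of p q] g.response_local[OF j t, of p q] by (simp_all add: q_def)
  ultimately show "X p j t = Y p j t"
    by (simp add: d_def)
qed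

text \<open>Well-founded induction along \<open>E\<close> assumes the claim for out-neighbours, so
  agreement starts at the sinks and travels backwards to every node.\<close>

lemma sink_responses_identify:
  assumes "network_response V E f \<alpha> X" "network_response V E g \<alpha> Y"
    and nz: "\<And>i j. (i, j) \<in> E \<Longrightarrow> f i j \<noteq> (\<lambda>_. 0)"
    and eq: "\<And>i p t. i \<in> sinks V E \<Longrightarrow> t \<ge> 0 \<Longrightarrow> X p i t = Y p i t"
  shows "same_edge_functions E f g"
proof -
  interpret f: network_response V E f \<alpha> X by fact
  note parent = response_determines_parent[OF assms(1,2) _ nz]
  have "wf E"
    using f.fin f.edges f.acyclic by (meson finite_SigmaI finite_acyclic_wf finite_subset)
  have all: "j \<in> V \<Longrightarrow> t \<ge> 0 \<Longrightarrow> X p j t = Y p j t" for j p t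
  proof (induction j arbitrary: p t rule: wf_induct_rule[OF \<open>wf E\<close>])
    case (1 j)
    show ?case
    proof (cases "j \<in> sinks V E")
      case True
      then show ?thesis
        using eq 1 by blast
    next
      case False
      then obtain i where "(i, j) \<in> E"
        using 1(2) by (auto simp: sinks_def)
      then show ?thesis
        using parent(2)[of i j] 1 f.edges by blast
    qed
  qed
  show ?thesis
    unfolding same_edge_functions_def using parent(1) all f.edges by fastforce
qed

text \<open>Casts both kinds of restricted data as responses, so that a single identification
  argument covers them.\<close>

lemma state_responses:
  assumes tree: "directed_tree V E" and f: "edge_functions E class_FZ f"
  shows "network_response V E f (\<lambda>t. t) (\<lambda>c i. state_fun V E f i (\<lambda>_. 0) (\<lambda>k _. c k))" (is ?excited)
    and "network_response V E f (\<lambda>_. 1) (\<lambda>x0 i. state_fun V E f i x0 (\<lambda>_ _. 0))" (is ?free)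
proof -
  have V: "finite V" "E \<subseteq> V \<times> V" and nocyc: "\<nexists>vs es. undirected_cycle E vs es"
    using tree by (auto simp: directed_tree_def)
  have wf: "wf (E\<inverse>)"
    by (rule wf_converse_edges[OF V tree_acyclic[OF nocyc]])
  have fc: "continuous_on UNIV (f i j)" and f0: "f i j 0 = 0" if "(i, j) \<in> E" for i j
    using f that real_analytic_continuous by (auto simp: edge_functions_def class_FZ_def)
  note state = state_fun_equation[of E V f, OF wf V(2) fc]
  show ?excited
  proof
    fix c :: "nat \<Rightarrow> real" and i and t :: real assume i: "i \<in> V" and t: "t \<ge> 0"
    let ?X = "\<lambda>j. state_fun V E f j (\<lambda>_. 0) (\<lambda>k _. c k)"
    let ?h = "\<lambda>s. \<Sum>j\<in>in_neighbors E i. f i j (?X j s)"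
    have "continuous_on {0..} ?h"
      by (intro continuous_intros continuous_on_compose2[OF fc state(1)])
        (use V in \<open>auto simp: in_neighbors_def\<close>)
    then have "continuous_on {0..t} ?h"
      by (rule continuous_on_subset) auto
    then have "?h integrable_on {0..t}"
      by (rule integrable_continuous_real)
    \<comment> \<open>The constant excitation integrates to \<open>c i * t\<close>, the parameter
      term for \<open>\<alpha> t = t\<close>.\<close>
    then have "integral {0..t} (\<lambda>s. ?h s + c i) = integral {0..t} ?h + c i * t"
      using t by (subst integral_add) auto
    then show "?X i t = c i * t + integral {0..t} ?h"
      using state(2)[of "\<lambda>k _. c k" i t "\<lambda>_. 0"] i t by simp
  qed (use V nocyc fc f0 state(1) in auto)
  show ?free
  proof
    fix x0 :: "nat \<Rightarrow> real" and i and t :: real assume i: "i \<in> V" and t: "t \<ge> 0"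
    show "state_fun V E f i x0 (\<lambda>_ _. 0) t = x0 i * 1 +
        integral {0..t} (\<lambda>s. \<Sum>j\<in>in_neighbors E i. f i j (state_fun V E f j x0 (\<lambda>_ _. 0) s))"
      using state(2)[of "\<lambda>_ _. 0" i t x0] i t by simp
  qed (use V nocyc fc f0 state(1) in auto)
qed


section \<open>Unmeasured sinks\<close>

text \<open>Linear networks for the counterexample: changing \<open>a\<close> at an unmeasured sink
  \<open>i\<close> is invisible at all other nodes.\<close>

definition gain_at :: "nat \<Rightarrow> real \<Rightarrow> nat \<Rightarrow> nat \<Rightarrow> real \<Rightarrow> real" where
  "gain_at i a k j z = (if k = i then a * z else z)"

lemma gain_at_edge_functions:
  assumes "a \<noteq> 0"
  shows "edge_functions E class_FZ (gain_at i a)"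
proof -
  have eq: "gain_at i a k j = (\<lambda>z. (if k = i then a else 1) * z)" for k j
    by (auto simp: gain_at_def)
  have "gain_at i a k j \<in> class_FZ" for k j
    unfolding eq class_FZ_def using real_analytic_scale by simp
  moreover have "gain_at i a k j \<noteq> (\<lambda>_. 0)" for k j
    using assms by (auto simp: gain_at_def fun_eq_iff intro!: exI[of _ 1])
  ultimately show ?thesis
    by (simp add: edge_functions_def)
qed

text \<open>A sink feeds no node, so only its own state has to be recomputed when its incoming gain
  changes.\<close>

lemma gain_at_trajectory:
  assumes E: "E \<subseteq> V \<times> V" and i: "i \<in> sinks V E" and u: "locally_integrable (u i)"
    and a: "a \<noteq> 0" and x: "trajectory V E (gain_at i a) x0 u x"
  shows "\<exists>y. trajectory V E (gain_at i b) x0 u y \<and> (\<forall>k. k \<noteq> i \<longrightarrow> y k = x k)"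
proof -
  have no_out: "(k, i) \<notin> E" for k
    using i by (auto simp: sinks_def)
  have iV: "i \<in> V"
    using i by (simp add: sinks_def)
  define h where "h s = (\<Sum>j\<in>in_neighbors E i. gain_at i b i j (x j s)) + u i s" for s
  define y where "y = x(i := \<lambda>t. x0 i + integral {0..t} h)"
  have yx: "y j = x j" if "j \<in> in_neighbors E k" for j k
    using that no_out by (auto simp: y_def in_neighbors_def)
  have "trajectory V E (gain_at i b) x0 u y"
    unfolding trajectory_def
  proof (intro ballI allI impI)
    fix k and t :: real assume k: "k \<in> V" and t: "t \<ge> 0"
    have sum: "(\<Sum>j\<in>in_neighbors E k. gain_at i b k j (y j s)) =
        (\<Sum>j\<in>in_neighbors E k. gain_at i b k j (x j s))" for s
      by (rule sum.cong) (auto simp: yx)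
    show "(\<lambda>s. (\<Sum>j\<in>in_neighbors E k. gain_at i b k j (y j s)) + u k s)
          absolutely_integrable_on {0..t} \<and>
        y k t = x0 k +
          integral {0..t} (\<lambda>s. (\<Sum>j\<in>in_neighbors E k. gain_at i b k j (y j s)) + u k s)"
    proof (cases "k = i")
      case True
      let ?s = "\<lambda>s. \<Sum>j\<in>in_neighbors E i. x j s"
      have "(\<lambda>s. (\<Sum>j\<in>in_neighbors E i. gain_at i a i j (x j s)) + u i s)
          absolutely_integrable_on {0..t}"
        using x iV t by (simp add: trajectory_def)
      then have "(\<lambda>s. a * ?s s + u i s) absolutely_integrable_on {0..t}"
        by (simp add: gain_at_def sum_distrib_left)
      moreover have ui: "u i absolutely_integrable_on {0..t}"
        using u t by (simp add: locally_integrable_def)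
      ultimately have "(\<lambda>s. (a * ?s s + u i s) - u i s) absolutely_integrable_on {0..t}"
        by (rule set_integral_diff(1))
      \<comment> \<open>The inflow, isolated by subtracting \<open>u i\<close>, is rescaled from
        gain \<open>a\<close> to gain \<open>b\<close> before \<open>u i\<close> is added
        back.\<close>
      then have "(\<lambda>s. (b / a) * ((a * ?s s + u i s) - u i s)) absolutely_integrable_on {0..t}"
        by (rule set_integrable_mult_right)
      from set_integral_add(1)[OF this ui]
      have "(\<lambda>s. (b / a) * ((a * ?s s + u i s) - u i s) + u i s)
          absolutely_integrable_on {0..t}" .
      also have "(\<lambda>s. (b / a) * ((a * ?s s + u i s) - u i s) + u i s) = h"
        using a by (simp add: h_def gain_at_def sum_distrib_left fun_eq_iff)
      finally show ?thesis
        unfolding sum unfolding True by (simp add: y_def h_def[symmetric])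
    next
      case False
      then have "gain_at i b k = gain_at i a k"
        by (simp add: gain_at_def fun_eq_iff)
      then show ?thesis
        unfolding sum using x k t False by (simp add: trajectory_def y_def)
    qed
  qed
  then show ?thesis
    by (intro exI[of _ y]) (simp add: y_def)
qed

lemma identifiable_imp_sinks_measured:
  assumes tree: "directed_tree V E" and edge: "E \<noteq> {}"
    and signals: "\<forall>u\<in>U. locally_integrable u" and ident: "identifiable V E U class_FZ M"
  shows "sinks V E \<subseteq> M"
proof
  fix i assume i: "i \<in> sinks V E"
  have E: "E \<subseteq> V \<times> V" and conn: "weakly_connected V E"
    using tree by (auto simp: directed_tree_def)
  have iV: "i \<in> V" and no_out: "\<And>k. (k, i) \<notin> E"
    using i by (auto simp: sinks_def)
  obtain a b where ab: "(a, b) \<in> E"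
    using edge by auto
  \<comment> \<open>As \<open>b\<close> has an outgoing edge, it differs from the sink
    \<open>i\<close>. The first edge on an undirected path from \<open>i\<close> to \<open>b\<close>
    must enter \<open>i\<close>.\<close>
  then have "(i, b) \<in> (E \<union> E\<inverse>)\<^sup>*" "b \<noteq> i"
    using conn E iV no_out by (auto simp: weakly_connected_def)
  then obtain j where ij: "(i, j) \<in> E"
    using no_out by (auto elim: converse_rtranclE)
  show "i \<in> M"
  proof (rule ccontr)
    assume "i \<notin> M"
    have "same_measurements V E U M (gain_at i 1) (gain_at i 2)"
      unfolding same_measurements_def
    proof (intro ballI allI impI)
      fix k x0 u and t :: real
      assume "k \<in> M" and u: "\<forall>k\<in>V. u k \<in> U"
      then have k: "k \<noteq> i" and ui: "locally_integrable (u i)"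
        using \<open>i \<notin> M\<close> signals iV by auto
      \<comment> \<open>Transferring trajectories in both directions gives the two definite
        descriptions the same predicate.\<close>
      have "(\<exists>x. trajectory V E (gain_at i 1) x0 u x \<and> y = x k t) \<longleftrightarrow>
          (\<exists>x. trajectory V E (gain_at i 2) x0 u x \<and> y = x k t)" for y
        using gain_at_trajectory[of E V i u 1 x0 _ 2] gain_at_trajectory[of E V i u 2 x0 _ 1] E i ui k
        by (metis one_neq_zero zero_neq_numeral)
      then show "state_fun V E (gain_at i 1) k x0 u t = state_fun V E (gain_at i 2) k x0 u t"
        unfolding state_fun_def by simp
    qed
    then have "same_edge_functions E (gain_at i 1) (gain_at i 2)"
      using ident gain_at_edge_functions[of 1] gain_at_edge_functions[of 2]
      unfolding identifiable_def by simp
    then have "gain_at i 1 i j 1 = gain_at i 2 i j 1"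
      using ij by (auto simp: same_edge_functions_def)
    then show False
      by (simp add: gain_at_def)
  qed
qed

theorem theorem1:
  fixes n :: nat and V :: "nat set" and E :: "(nat \<times> nat) set"
    and U :: "(real \<Rightarrow> real) set" and M :: "nat set"
  assumes V: "V = {1..n}"
    and tree: "directed_tree V E"
    and edge: "E \<noteq> {}"
    and signals: "\<forall>u\<in>U. locally_integrable u"
    and constants: "\<forall>c. (\<lambda>_. c) \<in> U"
    and measured: "M \<subseteq> V"
  shows "(identifiable V E U class_FZ M \<longleftrightarrow> sinks V E \<subseteq> M) \<and>
    (sinks V E \<subseteq> M \<longrightarrow>
      (\<forall>f g. edge_functions E class_FZ f \<longrightarrow> edge_functions E class_FZ g \<longrightarrow>
        ((\<forall>i\<in>M. \<forall>c :: nat \<Rightarrow> real. \<forall>t\<ge>0.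
            state_fun V E f i (\<lambda>_. 0) (\<lambda>k _. c k) t = state_fun V E g i (\<lambda>_. 0) (\<lambda>k _. c k) t)
          \<longrightarrow> same_edge_functions E f g) \<and>
        ((\<forall>i\<in>M. \<forall>x0 :: nat \<Rightarrow> real. \<forall>t\<ge>0.
            state_fun V E f i x0 (\<lambda>_ _. 0) t = state_fun V E g i x0 (\<lambda>_ _. 0) t)
          \<longrightarrow> same_edge_functions E f g)))"
proof -
  have FZ_nz: "f i j \<noteq> (\<lambda>_. 0)" if "edge_functions E class_FZ f" "(i, j) \<in> E" for f i j
    using that by (auto simp: edge_functions_def)
  have excited: "same_edge_functions E f g"
    if "sinks V E \<subseteq> M" "edge_functions E class_FZ f" "edge_functions E class_FZ g"
      "\<forall>i\<in>M. \<forall>c :: nat \<Rightarrow> real. \<forall>t\<ge>0.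
        state_fun V E f i (\<lambda>_. 0) (\<lambda>k _. c k) t = state_fun V E g i (\<lambda>_. 0) (\<lambda>k _. c k) t" for f g
    by (rule sink_responses_identify[OF state_responses(1)[OF tree that(2)]
          state_responses(1)[OF tree that(3)]]) (use that FZ_nz in auto)
  have free: "same_edge_functions E f g"
    if "sinks V E \<subseteq> M" "edge_functions E class_FZ f" "edge_functions E class_FZ g"
      "\<forall>i\<in>M. \<forall>x0 :: nat \<Rightarrow> real. \<forall>t\<ge>0.
        state_fun V E f i x0 (\<lambda>_ _. 0) t = state_fun V E g i x0 (\<lambda>_ _. 0) t" for f g
    by (rule sink_responses_identify[OF state_responses(2)[OF tree that(2)]
          state_responses(2)[OF tree that(3)]]) (use that FZ_nz in auto)
  have "identifiable V E U class_FZ M" if "sinks V E \<subseteq> M"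
    unfolding identifiable_def
  proof (intro allI impI)
    fix f g
    assume fg: "edge_functions E class_FZ f" "edge_functions E class_FZ g"
      and same: "same_measurements V E U M f g"
    \<comment> \<open>Full measurements contain the responses from rest to constant
      excitations.\<close>
    show "same_edge_functions E f g"
      using same constants by (intro excited[OF that fg]) (simp add: same_measurements_def)
  qed
  then show ?thesis
    using identifiable_imp_sinks_measured[OF tree edge signals] excited free by blast
qed

end
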